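(* Let $p$ be an odd prime, let $a$ be an integer with $1\leq a\leq p-1$, and let $i$ be a positive integer prime to $p$. For an integer $n$, let $(n)_0$ denote its least nonnegative residue modulo $p$, and let $\lfloor x\rfloor$ denote the integer part of $x$. Let $B_n$ denote the $n$-th Bernoulli number. (i) If $i$ is even and $i\not\equiv 2 \pmod{p-1}$, then $$(a^i-1)\frac{B_i}{i}\equiv\sum_{b=1}^{p-1}\left\lfloor\frac{ab}{p}\right\rfloor(ab)_0^{\,i-1}+p\,\frac{i-1}{2}\,a^{i-2}\sum_{b=1}^{p-1}\left\lfloor\frac{ab}{p}\right\rfloor^2 b^{i-2}\pmod{p^2}.$$ (ii) If $i$ is odd and $i\not\equiv 1\pmod{p-1}$ and $i\not\equiv 3\pmod{p-1}$, then $\sum_{b=1}^{p-1}\lfloor ab/p\rfloor(ab)_0^{i-1}$ is divisible by $p$ and $$B_{i-1}(a^i-1)\equiv \frac{2}{p}\sum_{b=1}^{p-1}\left\lfloor\frac{ab}{p}\right\rfloor(ab)_0^{\,i-1}+(i-1)\sum_{b=1}^{p-1}\left\lfloor\frac{ab}{p}\right\rfloor^2(ab)_0^{\,i-2}+p\,\frac{(i-1)(i-2)}{3}\sum_{b=1}^{p-1}\left\lfloor\frac{ab}{p}\right\rfloor^3(ab)_0^{\,i-3}\pmod{p^2}.$$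
   Context: Congruences are between rational numbers whose denominators are prime to $p$ (i.e. in $\mathbb{Z}_{(p)}$). Bernoulli numbers are defined by $\frac{t}{e^t-1}=\sum_{n\ge0}B_n\frac{t^n}{n!}$. *)

theory Defs
  imports
    "HOL-Computational_Algebra.Formal_Power_Series"
    "HOL-Number_Theory.Cong"
begin

(* Normalised by t / (exp t - 1), so bernoulli 1 = -1/2. The quotient is the fps
   division that first cancels the common factor t. *)
definition bernoulli :: "nat \<Rightarrow> rat" where
  "bernoulli n = fact n * fps_nth (fps_X / (fps_exp 1 - 1)) n"

lemma bernoulli_egf:
  "Abs_fps (\<lambda>n. bernoulli n / fact n) * (fps_exp 1 - 1) = fps_X"
proof -
  let ?E = "fps_exp 1 - 1 :: rat fps"
  have "fps_nth ?E 1 \<noteq> 0" by simp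
  then have nz: "?E \<noteq> 0" by (metis fps_zero_nth)
  have "subdegree ?E = 1" by (rule subdegreeI) auto
  then have "subdegree ?E \<le> subdegree (fps_X :: rat fps)" by simp
  then have dvd: "?E dvd fps_X" using nz by (simp add: fps_dvd_iff)
  have "Abs_fps (\<lambda>n. bernoulli n / fact n) = fps_X / ?E"
    by (rule fps_ext) (simp add: bernoulli_def)
  then show ?thesis using dvd by simp
qed

definition p_integral :: "int \<Rightarrow> rat \<Rightarrow> bool" where
  "p_integral p x \<longleftrightarrow> coprime (snd (quotient_of x)) p"

(* Congruence modulo the ideal p^k Z_(p); membership of both sides in Z_(p) is part of
   the relation. *)
definition rat_cong :: "int \<Rightarrow> nat \<Rightarrow> rat \<Rightarrow> rat \<Rightarrow> bool" where
  "rat_cong p k x y \<longleftrightarrow>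
     p_integral p x \<and> p_integral p y \<and> (\<exists>z. p_integral p z \<and> x - y = of_int p ^ k * z)"

end

(* Write ab = pq + r with 0 <= r < p. Since b -> r permutes 1..p-1, expanding (pq + r)^i
   binomially and summing over b turns (a^i - 1) * sum b^i into a series in p whose coefficients are
   the sums of q^k r^(i-k). On the other side, sum b^i = p * sum_k (i choose k) B_(i-k) p^k / (k+1).
   As p B_n is p-integral, and B_n itself if p - 1 does not divide n, both series can be truncated
   after k = 2 (i even, where p >= 5) or after k = 3 (i odd, where p >= 7); the excluded
   residue classes of i rule out the smaller primes. *)
theory Submission
  imports Defs "HOL-Number_Theory.Residue_Primitive_Roots"
begin

section \<open>Ideals of the localisation at p\<close>

text \<open>The reduced denominator divides the denominator of any other representation, so one
  fraction with denominator prime to \<open>p\<close> suffices. The closure proofs below therefore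
  never reduce fractions.\<close>

lemma p_integral_iff:
  assumes "prime p"
  shows "p_integral p x \<longleftrightarrow> (\<exists>m n. coprime n p \<and> n \<noteq> 0 \<and> x = of_int m / of_int n)"
proof
  assume "p_integral p x"
  moreover obtain m n where mn: "quotient_of x = (m, n)" by force
  ultimately show "\<exists>m n. coprime n p \<and> n \<noteq> 0 \<and> x = of_int m / of_int n"
    using quotient_of_div[OF mn] quotient_of_denom_pos[OF mn] by (auto simp: p_integral_def)
next
  assume "\<exists>m n. coprime n p \<and> n \<noteq> 0 \<and> x = of_int m / of_int n"
  then obtain m n where *: "coprime n p" "n \<noteq> 0" "x = of_int m / of_int n" by blast
  obtain c d where cd: "quotient_of x = (c, d)" by force
  have "d > 0" "coprime c d" "x = of_int c / of_int d"
    using quotient_of_denom_pos[OF cd] quotient_of_coprime[OF cd] quotient_of_div[OF cd] by auto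
  with * have "of_int (c * n) = (of_int (m * d) :: rat)" by (simp add: field_simps)
  then have "d dvd c * n" by (metis dvd_triv_right of_int_eq_iff)
  then have "d dvd n" using \<open>coprime c d\<close>
    by (simp add: coprime_commute coprime_dvd_mult_right_iff)
  then show "p_integral p x"
    using \<open>coprime n p\<close> cd by (auto simp: p_integral_def intro: coprime_divisors)
qed

lemma p_integral_of_int [simp]: "p_integral p (of_int m)"
  by (simp add: p_integral_def)

lemma p_integral_of_nat [simp]: "p_integral p (of_nat m)"
  using p_integral_of_int[of p "int m"] by simp

lemma p_integral_add:
  assumes "prime p" "p_integral p x" "p_integral p y" shows "p_integral p (x + y)"
proof -
  obtain m n m' n' where "coprime n p" "n \<noteq> 0" "x = of_int m / of_int n"
    "coprime n' p" "n' \<noteq> 0" "y = of_int m' / of_int n'"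
    using assms by (auto simp: p_integral_iff)
  then have "coprime (n * n') p \<and> n * n' \<noteq> 0 \<and>
      x + y = of_int (m * n' + m' * n) / of_int (n * n')"
    by (simp add: field_simps)
  then show ?thesis using p_integral_iff[OF assms(1)] by blast
qed

lemma p_integral_mult:
  assumes "prime p" "p_integral p x" "p_integral p y" shows "p_integral p (x * y)"
proof -
  obtain m n m' n' where "coprime n p" "n \<noteq> 0" "x = of_int m / of_int n"
    "coprime n' p" "n' \<noteq> 0" "y = of_int m' / of_int n'"
    using assms by (auto simp: p_integral_iff)
  then have "coprime (n * n') p \<and> n * n' \<noteq> 0 \<and>
      x * y = of_int (m * m') / of_int (n * n')"
    by simp
  then show ?thesis using p_integral_iff[OF assms(1)] by blast
qed

lemma p_integral_inverse_int:
  assumes "prime p" "coprime n p" shows "p_integral p (1 / of_int n)"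
proof -
  have "n \<noteq> 0" using assms by auto
  with assms show ?thesis by (metis p_integral_iff of_int_1)
qed

text \<open>The ideal p^k Z_(p) as a predicate on rationals. Level \<open>k = 0\<close> is Z_(p)
  itself, so integrality and congruences share one set of closure rules.\<close>

definition p_ideal :: "int \<Rightarrow> nat \<Rightarrow> rat \<Rightarrow> bool" where
  "p_ideal p k x \<longleftrightarrow> (\<exists>z. p_integral p z \<and> x = of_int p ^ k * z)"

lemma p_ideal_0 [simp]: "p_ideal p 0 x \<longleftrightarrow> p_integral p x"
  by (simp add: p_ideal_def)

lemma rat_cong_iff:
  "rat_cong p k x y \<longleftrightarrow> p_integral p x \<and> p_integral p y \<and> p_ideal p k (x - y)"
  by (simp add: rat_cong_def p_ideal_def)

lemma p_ideal_mult:
  assumes "prime p" "p_ideal p k x" "p_ideal p l y" shows "p_ideal p (k + l) (x * y)"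
proof -
  obtain u v where "p_integral p u" "x = of_int p ^ k * u" "p_integral p v" "y = of_int p ^ l * v"
    using assms by (auto simp: p_ideal_def)
  then show ?thesis unfolding p_ideal_def
    by (intro exI[of _ "u * v"]) (simp add: p_integral_mult[OF assms(1)] power_add)
qed

lemma p_ideal_mult_left:
  assumes "prime p" "p_integral p x" "p_ideal p l y" shows "p_ideal p l (x * y)"
  using p_ideal_mult[of p 0 x l y] assms by simp

lemma p_ideal_add:
  assumes "prime p" "p_ideal p k x" "p_ideal p k y" shows "p_ideal p k (x + y)"
proof -
  obtain u v where "p_integral p u" "x = of_int p ^ k * u" "p_integral p v" "y = of_int p ^ k * v"
    using assms by (auto simp: p_ideal_def)
  then show ?thesis unfolding p_ideal_def
    by (intro exI[of _ "u + v"]) (simp add: p_integral_add[OF assms(1)] distrib_left)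
qed

lemma p_ideal_uminus:
  assumes "prime p" "p_ideal p k x" shows "p_ideal p k (- x)"
  using p_ideal_mult_left[OF assms(1) _ assms(2), of "-1"] p_integral_of_int[of p "-1"] by simp

lemma p_ideal_diff:
  assumes "prime p" "p_ideal p k x" "p_ideal p k y" shows "p_ideal p k (x - y)"
  using p_ideal_add[OF assms(1,2) p_ideal_uminus[OF assms(1,3)]] by simp

lemma p_ideal_sum:
  assumes "prime p" "\<And>x. x \<in> A \<Longrightarrow> p_ideal p k (f x)" shows "p_ideal p k (sum f A)"
proof -
  have "p_ideal p k 0" using p_integral_of_int[of p 0] by (auto simp: p_ideal_def)
  with assms show ?thesis
    by (induction A rule: infinite_finite_induct) (auto intro: p_ideal_add)
qed

text \<open>The ideal meets the integers in exactly p^k Z, because a denominator prime to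
  \<open>p\<close> cannot absorb factors of \<open>p\<close>. This transfers divisibility of integer
  sums to and from the localisation.\<close>

lemma p_ideal_of_int_iff:
  assumes "prime p" shows "p_ideal p k (of_int m) \<longleftrightarrow> p ^ k dvd m"
proof
  assume "p_ideal p k (of_int m)"
  then obtain c d where "coprime d p" "d \<noteq> 0"
    "of_int m = of_int p ^ k * (of_int c / (of_int d :: rat))"
    using assms by (auto simp: p_ideal_def p_integral_iff)
  then have "of_int (m * d) = (of_int (p ^ k * c) :: rat)" by (simp add: field_simps)
  then have "p ^ k dvd m * d" by (metis dvd_triv_left of_int_eq_iff)
  then show "p ^ k dvd m" using \<open>coprime d p\<close>
    by (meson coprime_commute coprime_dvd_mult_left_iff coprime_power_left_iff)
next
  assume "p ^ k dvd m"
  then obtain c where "m = p ^ k * c" by blast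
  then show "p_ideal p k (of_int m)" unfolding p_ideal_def
    by (intro exI[of _ "of_int c"]) simp
qed

lemma p_ideal_divide_p:
  assumes "prime p" "p_ideal p (Suc k) x" shows "p_ideal p k (x / of_int p)"
proof -
  have "p \<noteq> 0" using assms by auto
  with assms(2) show ?thesis by (auto simp: p_ideal_def)
qed

lemma p_ideal_p_mult:
  assumes "p_ideal p k x" shows "p_ideal p (Suc k) (of_int p * x)"
  using assms by (auto simp: p_ideal_def)

lemma p_ideal_integral:
  assumes "prime p" "p_ideal p k x" shows "p_integral p x"
  using assms by (auto simp: p_ideal_def intro!: p_integral_mult simp flip: of_int_power)

text \<open>The bound n < p^(d+1) limits the p-adic valuation \<open>e\<close> of \<open>n\<close>
  to at most \<open>d\<close>, so division by \<open>n\<close> costs at most \<open>d\<close> of the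
  m + d factors \<open>p\<close>.\<close>

lemma p_ideal_power_divide:
  fixes p :: int and n m d :: nat
  assumes "prime p" "0 < n" "int n < p ^ Suc d"
  shows "p_ideal p m (of_int p ^ (m + d) / of_nat n)"
proof -
  have "int n \<noteq> 0" "\<not> is_unit p" using assms by auto
  then obtain e u where u: "int n = p ^ e * u" "\<not> p dvd u"
    using multiplicity_decompose'[of "int n" p] by metis
  have "p > 1" using assms(1) prime_gt_1_int by blast
  have "u > 0" using u(1) assms(2) \<open>p > 1\<close>
    by (metis of_nat_0_less_iff zero_less_mult_pos zero_less_power less_trans zero_less_one)
  then have "p ^ e \<le> int n" using u(1) \<open>p > 1\<close> by simp
  then have "p ^ e < p ^ Suc d" using assms(3) by simp
  then have "e \<le> d" using \<open>p > 1\<close> by (simp only: power_strict_increasing_iff)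
  then have d: "d = e + (d - e)" by simp
  have "coprime u p" using u(2) assms(1) by (simp add: coprime_commute prime_imp_coprime)
  then have "p_integral p (of_int (p ^ (d - e)) * (1 / of_int u))"
    using assms(1) by (intro p_integral_mult p_integral_of_int p_integral_inverse_int)
  moreover have "(of_nat n :: rat) = of_int p ^ e * of_int u"
    using arg_cong[OF u(1), of "of_int :: int \<Rightarrow> rat"] by simp
  then have "of_int p ^ (m + d) / (of_nat n :: rat)
      = of_int p ^ m * (of_int (p ^ (d - e)) * (1 / of_int u))"
    using \<open>p > 1\<close> by (subst d) (simp add: power_add)
  ultimately show ?thesis unfolding p_ideal_def by blast
qed

section \<open>Power sums and Bernoulli numbers\<close>

lemma bij_betw_mult_mod:
  fixes a p :: int
  assumes "prime p" "coprime a p"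
  shows "bij_betw (\<lambda>b. (a * b) mod p) {1..p - 1} {1..p - 1}"
proof -
  have "p > 1" using assms(1) prime_gt_1_int by blast
  have inj: "inj_on (\<lambda>b. (a * b) mod p) {1..p - 1}"
  proof (rule inj_onI)
    fix x y assume xy: "x \<in> {1..p - 1}" "y \<in> {1..p - 1}" "a * x mod p = a * y mod p"
    then have "[a * x = a * y] (mod p)" by (simp add: cong_def)
    then have "[x = y] (mod p)" using assms(2) by (simp add: cong_mult_lcancel)
    then show "x = y" using xy by (simp add: cong_def)
  qed
  have "(a * b) mod p \<in> {1..p - 1}" if "b \<in> {1..p - 1}" for b
  proof -
    have "\<not> p dvd b" using that zdvd_not_zless[of b p] by auto
    then have "\<not> p dvd a * b" using assms
      by (simp add: coprime_commute coprime_dvd_mult_right_iff)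
    then have "(a * b) mod p \<noteq> 0" by (simp add: dvd_eq_mod_eq_0)
    moreover have "(a * b) mod p \<ge> 0" "(a * b) mod p < p" using \<open>p > 1\<close> by auto
    ultimately show ?thesis by simp
  qed
  then have "(\<lambda>b. (a * b) mod p) ` {1..p - 1} \<subseteq> {1..p - 1}" by blast
  then show ?thesis using inj by (simp add: bij_betw_def endo_inj_surj)
qed

lemma sum_powers_mult_mod:
  fixes a p :: int
  assumes "prime p" "coprime a p"
  shows "(\<Sum>b = 1..p - 1. ((a * b) mod p) ^ n) = (\<Sum>b = 1..p - 1. b ^ n)"
  using sum.reindex_bij_betw[OF bij_betw_mult_mod[OF assms], of "\<lambda>b. b ^ n"] .

text \<open>For a primitive root g, replacing b by g b permutes the nonzero residues but multiplies
  the sum by g^n modulo \<open>p\<close>. As g^n is not 1 modulo \<open>p\<close>, the sum must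
  vanish there.\<close>

lemma prime_dvd_sum_powers:
  fixes p :: int
  assumes "prime p" "\<not> (p - 1) dvd int n"
  shows "p dvd (\<Sum>b = 1..p - 1. b ^ n)"
proof -
  define q where "q = nat p"
  have q: "p = int q" "prime q" using assms(1) by (auto simp: q_def prime_ge_0_int)
  then have "q > 1" using prime_gt_1_nat by blast
  obtain g where g: "residue_primroot q g"
    using prime_primitive_root_exists[OF \<open>q > 1\<close> q(2)] by blast
  have "\<not> (q - 1) dvd n"
    using assms(2) \<open>q > 1\<close> q(1) by (metis of_nat_1 of_nat_diff of_nat_dvd_iff less_imp_le)
  \<comment> \<open>The order of \<open>g\<close> is \<open>totient q\<close>, that is q - 1, which
    does not divide \<open>n\<close>.\<close>
  then have "\<not> [g ^ n = 1] (mod q)"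
    using g q(2) by (simp add: ord_divides' residue_primroot_def totient_prime)
  then have ng: "\<not> [int g ^ n = 1] (mod p)"
    using q(1) by (metis cong_int_iff of_nat_1 of_nat_power)
  have cop: "coprime (int g) p"
    using g q(1) by (simp add: residue_primroot_def coprime_commute)
  let ?S = "\<Sum>b = 1..p - 1. b ^ n"
  have "[(\<Sum>b = 1..p - 1. ((int g * b) mod p) ^ n) = (\<Sum>b = 1..p - 1. (int g * b) ^ n)] (mod p)"
    by (intro cong_sum cong_pow) (simp add: cong_def)
  then have "[?S = int g ^ n * ?S] (mod p)"
    by (simp add: sum_powers_mult_mod[OF assms(1) cop] power_mult_distrib sum_distrib_left)
  then have "p dvd (int g ^ n - 1) * ?S"
    by (simp add: cong_iff_dvd_diff left_diff_distrib dvd_diff_commute)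
  then show ?thesis
    using ng assms(1) by (simp add: cong_iff_dvd_diff prime_dvd_mult_iff)
qed

section \<open>Generating function identities for Bernoulli numbers\<close>

lemma bernoulli_0 [simp]: "bernoulli 0 = 1"
proof -
  have "fps_nth (Abs_fps (\<lambda>n. bernoulli n / fact n) * (fps_exp 1 - 1)) 1 = fps_nth fps_X 1"
    by (simp only: bernoulli_egf)
  then show ?thesis by (simp add: fps_mult_nth)
qed

text \<open>For B(t) = t / (e^t - 1) one has B(-t) = B(t) + t; the coefficients of t^n are
  compared.\<close>

lemma bernoulli_reflect: "(-1) ^ n * bernoulli n = bernoulli n + (if n = 1 then 1 else 0)"
proof -
  let ?B = "Abs_fps (\<lambda>n. bernoulli n / fact n)"
  \<comment> \<open>This is -t, written as a constant times \<open>fps_X\<close> so that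
    \<open>fps_compose_linear\<close> applies at the end.\<close>
  let ?c = "fps_const (-1) * fps_X :: rat fps"
  have c: "?c = - fps_X" by (simp add: fps_const_neg[symmetric] del: fps_const_neg)
  have "(?B * (fps_exp 1 - 1)) oo ?c = - fps_X" by (subst bernoulli_egf) (simp add: c)
  moreover have "(?B * (fps_exp 1 - 1)) oo ?c = (?B oo ?c) * (fps_exp (-1) - 1)"
    by (subst fps_compose_mult_distrib) (simp_all add: fps_compose_sub_distrib)
  ultimately have "(?B oo ?c) * (fps_exp (-1) - 1) = - fps_X" by simp
  \<comment> \<open>The factor e^t turns e^(-t) - 1 into -(e^t - 1), a factor that can be cancelled
    later.\<close>
  then have "(?B oo ?c) * ((fps_exp (-1) - 1) * fps_exp 1) = - fps_X * fps_exp 1"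
    by (simp add: mult.assoc[symmetric])
  moreover have "(fps_exp (-1) - 1) * fps_exp (1 :: rat) = - (fps_exp 1 - 1)"
    by (simp add: left_diff_distrib fps_exp_add_mult[symmetric])
  ultimately have "(?B oo ?c) * (fps_exp 1 - 1) = fps_X * fps_exp 1"
    by (simp only: mult_minus_left mult_minus_right neg_equal_iff_equal)
  also have "\<dots> = (?B + fps_X) * (fps_exp 1 - 1)"
    by (simp only: distrib_right bernoulli_egf) (simp add: right_diff_distrib)
  finally have "(?B oo ?c) = ?B + fps_X" by (simp add: fps_exp_eq_1_iff)
  then have "fps_nth (?B oo ?c) n = fps_nth (?B + fps_X) n" by simp
  then show ?thesis by (subst (asm) fps_compose_linear) (auto simp: field_simps split: if_splits)
qed

lemma bernoulli_odd_eq_0: "odd n \<Longrightarrow> n \<noteq> 1 \<Longrightarrow> bernoulli n = 0"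
  using bernoulli_reflect[of n] by simp

text \<open>The sum of e^(bt) over b < N is a geometric series, so t times it equals B(t) (e^(Nt) -
  1) with B(t) = t / (e^t - 1). The formula is the coefficient of t^(n+1).\<close>

lemma sum_powers_bernoulli_nat:
  "(\<Sum>b<N. (of_nat b :: rat) ^ n)
     = (\<Sum>k\<le>n. of_nat (n choose k) * bernoulli (n - k) * of_nat N ^ Suc k / of_nat (Suc k))"
proof -
  let ?B = "Abs_fps (\<lambda>n. bernoulli n / fact n)"
  let ?S = "\<Sum>b<N. fps_exp (of_nat b) :: rat fps"
  have "?S * (fps_exp 1 - 1) = fps_exp (of_nat N) - 1"
    by (induction N) (simp_all add: algebra_simps fps_exp_add_mult)
  moreover have "fps_X * ?S = ?B * (?S * (fps_exp 1 - 1))"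
    unfolding bernoulli_egf[symmetric] by (simp only: mult_ac)
  ultimately have "fps_X * ?S = ?B * (fps_exp (of_nat N) - 1)" by simp
  then have "fps_nth (fps_X * ?S) (Suc n) = fps_nth (?B * (fps_exp (of_nat N) - 1)) (Suc n)"
    by simp
  also have "fps_nth (fps_X * ?S) (Suc n) = (\<Sum>b<N. of_nat b ^ n) / fact n"
    by (simp add: fps_sum_nth sum_divide_distrib)
  also have "fps_nth (?B * (fps_exp (of_nat N) - 1)) (Suc n)
      = (\<Sum>j\<le>n. bernoulli j / fact j * (of_nat N ^ (Suc n - j) / fact (Suc n - j)))"
    by (simp add: fps_mult_nth atLeast0AtMost) (simp add: mult.commute)
  also have "\<dots> = (\<Sum>k\<le>n. bernoulli (n - k) / fact (n - k) * (of_nat N ^ Suc k / fact (Suc k)))"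
    by (rule sum.reindex_bij_witness[of _ "\<lambda>k. n - k" "\<lambda>k. n - k"]) (auto simp: Suc_diff_le)
  finally have "(\<Sum>b<N. (of_nat b :: rat) ^ n)
      = fact n * (\<Sum>k\<le>n. bernoulli (n - k) / fact (n - k) * (of_nat N ^ Suc k / fact (Suc k)))"
    by (simp add: field_simps)
  also have "\<dots> = (\<Sum>k\<le>n. of_nat (n choose k) * bernoulli (n - k) * of_nat N ^ Suc k / of_nat (Suc k))"
    unfolding sum_distrib_left
    by (rule sum.cong) (simp_all add: binomial_fact field_simps)
  finally show ?thesis .
qed

lemma sum_powers_bernoulli:
  fixes p :: int
  assumes "p > 0" "n > 0"
  shows "of_int (\<Sum>b = 1..p - 1. b ^ n)
     = of_int p * (\<Sum>k\<le>n. of_nat (n choose k) * bernoulli (n - k) * of_int p ^ k / of_nat (Suc k))"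
proof -
  \<comment> \<open>The term b = 0 is harmless only because n > 0; otherwise it would be 0^0 =
    1.\<close>
  have "(\<Sum>b = 1..p - 1. b ^ n) = (\<Sum>b = 0..p - 1. b ^ n)"
    using assms by (intro sum.mono_neutral_left) auto
  also have "\<dots> = (\<Sum>b<nat p. int b ^ n)"
    using assms by (intro sum.reindex_bij_witness[of _ int nat]) auto
  finally have "of_int (\<Sum>b = 1..p - 1. b ^ n) = (\<Sum>b<nat p. (of_nat b :: rat) ^ n)" by simp
  with assms show ?thesis
    by (simp add: sum_powers_bernoulli_nat sum_distrib_left mult_ac)
qed

section \<open>Denominators of Bernoulli numbers at p\<close>

text \<open>The k = 0 term of the power sum formula is isolated, giving a recursion for p B_n. The
  brackets pair p B_(n-k) with p^k / (k+1), since these two factors are estimated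
  separately.\<close>

lemma p_mult_bernoulli_eq:
  fixes p :: int
  assumes "p > 0" "n > 0"
  shows "of_int p * bernoulli n = of_int (\<Sum>b = 1..p - 1. b ^ n)
    - (\<Sum>k = 1..n. of_nat (n choose k) *
         ((of_int p * bernoulli (n - k)) * (of_int p ^ k / of_nat (Suc k))))"
proof -
  have "{..n} = insert 0 {1..n}" by auto
  then have "of_int (\<Sum>b = 1..p - 1. b ^ n) = of_int p * (bernoulli n +
      (\<Sum>k = 1..n. of_nat (n choose k) * bernoulli (n - k) * of_int p ^ k / of_nat (Suc k)))"
    using assms by (subst sum_powers_bernoulli) simp_all
  then show ?thesis by (simp add: distrib_left sum_distrib_left mult_ac)
qed

text \<open>A weak form of von Staudt-Clausen, by strong induction on the recursion: k + 1 < 2^(k+1)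
  <= p^(k+1) makes p^k / (k+1) integral.\<close>

lemma p_integral_p_mult_bernoulli:
  assumes "prime p" shows "p_integral p (of_int p * bernoulli n)"
proof (induction n rule: less_induct)
  case (less n)
  have "p > 1" using assms prime_gt_1_int by blast
  show ?case
  proof (cases "n = 0")
    case False
    then have "p > 0" "n > 0" using \<open>p > 1\<close> by auto
    have "p_ideal p 0 (of_nat (n choose k) *
        ((of_int p * bernoulli (n - k)) * (of_int p ^ k / of_nat (Suc k))))" if k: "k \<in> {1..n}" for k
    proof -
      have "int (Suc k) < 2 ^ Suc k" by (metis of_nat_less_two_power)
      also have "\<dots> \<le> p ^ Suc k" using \<open>p > 1\<close> by (intro power_mono) auto
      finally have "p_ideal p 0 (of_int p ^ (0 + k) / of_nat (Suc k))"
        by (intro p_ideal_power_divide assms) auto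
      moreover have "p_integral p (of_int p * bernoulli (n - k))" using less k by simp
      ultimately show ?thesis by (intro p_ideal_mult_left assms) auto
    qed
    moreover have "p_ideal p 0 (of_int (\<Sum>b = 1..p - 1. b ^ n))"
      by (simp only: p_ideal_0 p_integral_of_int)
    ultimately have "p_ideal p 0 (of_int p * bernoulli n)"
      unfolding p_mult_bernoulli_eq[OF \<open>p > 0\<close> \<open>n > 0\<close>]
      by (intro p_ideal_diff p_ideal_sum assms)
    then show ?thesis by simp
  qed (use p_integral_of_int[of p p] in simp)
qed

text \<open>The same recursion is read modulo \<open>p\<close>. The power sum vanishes because p - 1
  does not divide \<open>n\<close>, and k + 1 < 3^k <= p^k puts every p^k / (k+1) into the ideal.
  Hence p B_n is divisible by \<open>p\<close>.\<close>

lemma p_integral_bernoulli: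
  assumes "prime p" "odd p" "\<not> (p - 1) dvd int n"
  shows "p_integral p (bernoulli n)"
proof -
  have "p > 1" using assms prime_gt_1_int by blast
  with \<open>odd p\<close> have "p \<ge> 3" by (cases "p = 2") auto
  have "p > 0" "n > 0" using \<open>p > 1\<close> assms(3) by (auto intro!: Nat.gr0I)
  have "p_ideal p 1 (of_nat (n choose k) *
      ((of_int p * bernoulli (n - k)) * (of_int p ^ k / of_nat (Suc k))))" if k: "k \<in> {1..n}" for k
  proof -
    obtain d where d: "k = 1 + d" using k by (cases k) auto
    have "int (Suc (Suc d)) < 3 ^ Suc d" by (induction d) auto
    also have "\<dots> \<le> p ^ Suc d" using \<open>p \<ge> 3\<close> by (intro power_mono) auto
    finally have "p_ideal p 1 (of_int p ^ (1 + d) / of_nat (Suc k))"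
      using d by (intro p_ideal_power_divide assms) auto
    then show ?thesis unfolding d
      using p_integral_p_mult_bernoulli[OF assms(1)] by (intro p_ideal_mult_left assms) auto
  qed
  moreover have "p_ideal p 1 (of_int (\<Sum>b = 1..p - 1. b ^ n))"
    using prime_dvd_sum_powers[OF assms(1,3)] assms(1) by (simp only: p_ideal_of_int_iff power_one_right)
  ultimately have "p_ideal p 1 (of_int p * bernoulli n)"
    unfolding p_mult_bernoulli_eq[OF \<open>p > 0\<close> \<open>n > 0\<close>]
    by (intro p_ideal_diff p_ideal_sum assms)
  then show ?thesis using p_ideal_divide_p[of p 0 "of_int p * bernoulli n"] assms(1) \<open>p > 1\<close> by simp
qed

section \<open>The truncated congruence\<close>

text \<open>With k = m + d + 1 this bounds k + 1, the larger denominator in the tails. The base case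
  m + 2 < 2m + 1 is where m > 1 enters.\<close>

lemma Suc_less_odd_power:
  assumes "1 < m" shows "int (Suc (Suc (m + d))) < (2 * int m + 1) ^ Suc d"
proof (induction d)
  case (Suc d)
  have "int (Suc (Suc (m + Suc d))) \<le> 2 * int (Suc (Suc (m + d)))" by simp
  also have "\<dots> < (2 * int m + 1) * (2 * int m + 1) ^ Suc d"
    using Suc assms by (intro mult_le_less_imp_less) auto
  finally show ?case by simp
qed (use assms in simp)

text \<open>The denominator \<open>k\<close> occurs in the quotient-remainder series and
  \<open>Suc k\<close> in the Bernoulli series. In both, one factor \<open>p\<close> is already
  spent, hence the exponent k - 1.\<close>

lemma p_ideal_power_divide_tail:
  assumes "prime p" "1 < m" "2 * int m + 1 \<le> p" "m < k"
  shows "p_ideal p m (of_int p ^ (k - 1) / of_nat k)"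
    and "p_ideal p m (of_int p ^ (k - 1) / of_nat (Suc k))"
proof -
  obtain d where d: "k = Suc (m + d)" using \<open>m < k\<close> less_iff_Suc_add by blast
  have "int (Suc k) < (2 * int m + 1) ^ Suc d" using Suc_less_odd_power[OF assms(2)] d by simp
  also have "\<dots> \<le> p ^ Suc d" using assms(3) by (intro power_mono) auto
  finally have le: "int (Suc k) < p ^ Suc d" .
  have k: "k - 1 = m + d" using d by simp
  show "p_ideal p m (of_int p ^ (k - 1) / of_nat (Suc k))"
    unfolding k using le by (intro p_ideal_power_divide assms) auto
  show "p_ideal p m (of_int p ^ (k - 1) / of_nat k)"
    unfolding k using le d by (intro p_ideal_power_divide assms) auto
qed

text \<open>The k = 0 term of the binomial expansion is the power sum of the residues of ab, which
  equals that of the b. Moving it to the left produces the factor a^n - 1.\<close>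

lemma sum_powers_mult_eq_div_mod_sum:
  fixes p a :: int
  assumes "prime p" "coprime a p"
  shows "(a ^ n - 1) * (\<Sum>b = 1..p - 1. b ^ n)
    = (\<Sum>k = 1..n. of_nat (n choose k) * p ^ k *
        (\<Sum>b = 1..p - 1. ((a * b) div p) ^ k * ((a * b) mod p) ^ (n - k)))"
proof -
  let ?q = "\<lambda>b. (a * b) div p" and ?r = "\<lambda>b. (a * b) mod p"
  have "(a * b) ^ n = (\<Sum>k\<le>n. of_nat (n choose k) * p ^ k * (?q b ^ k * ?r b ^ (n - k)))" for b
  proof -
    have "(a * b) ^ n = (p * ?q b + ?r b) ^ n" by simp
    then show ?thesis by (simp only: binomial_ring power_mult_distrib mult_ac)
  qed
  then have "a ^ n * (\<Sum>b = 1..p - 1. b ^ n)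
      = (\<Sum>b = 1..p - 1. \<Sum>k\<le>n. of_nat (n choose k) * p ^ k * (?q b ^ k * ?r b ^ (n - k)))"
    by (simp add: sum_distrib_left power_mult_distrib)
  also have "\<dots> = (\<Sum>k\<le>n. of_nat (n choose k) * p ^ k * (\<Sum>b = 1..p - 1. ?q b ^ k * ?r b ^ (n - k)))"
    by (subst sum.swap) (simp add: sum_distrib_left)
  also have "{..n} = insert 0 {1..n}" by auto
  finally show ?thesis
    by (simp add: left_diff_distrib sum_powers_mult_mod[OF assms])
qed

text \<open>Two expansions of (a^i - 1) times the power sum, divided by p i, agree exactly. The
  heads therefore differ by the difference of the tails, all of whose terms lie in the
  ideal.\<close>

lemma bernoulli_div_mod_sum_truncated:
  fixes p a :: int and i m :: nat
  assumes "prime p" "coprime a p" "coprime (int i) p"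
    and m: "1 < m" "2 * int m + 1 \<le> p" "m < i"
  defines "F \<equiv> \<lambda>k. \<Sum>b = 1..p - 1. ((a * b) div p) ^ k * ((a * b) mod p) ^ (i - k)"
  shows "p_ideal p m
    ((of_int a ^ i - 1) / of_nat i *
       (\<Sum>k\<le>m. of_nat (i choose k) * bernoulli (i - k) * of_int p ^ k / of_nat (Suc k))
     - (\<Sum>k = 1..m. of_nat ((i - 1) choose (k - 1)) * (of_int p ^ (k - 1) / of_nat k) * of_int (F k)))"
proof -
  let ?l = "\<lambda>k. of_nat (i choose k) * bernoulli (i - k) * of_int p ^ k / of_nat (Suc k)"
  let ?r = "\<lambda>k. of_nat ((i - 1) choose (k - 1)) * (of_int p ^ (k - 1) / of_nat k) * of_int (F k)"
  let ?c = "of_int a ^ i - 1 :: rat"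
  have "p > 0" using assms(1) prime_gt_0_int by blast
  have "i > 0" using m by simp
  have "{..i} = {..m} \<union> {Suc m..i}" "{1..i} = {1..m} \<union> {Suc m..i}" using m by auto
  then have split: "sum ?l {..i} = sum ?l {..m} + sum ?l {Suc m..i}"
    "sum ?r {1..i} = sum ?r {1..m} + sum ?r {Suc m..i}"
    by (simp_all add: sum.union_disjoint disjoint_iff)
  have "?c * of_int (\<Sum>b = 1..p - 1. b ^ i)
      = (\<Sum>k = 1..i. of_nat (i choose k) * of_int p ^ k * of_int (F k))"
    using arg_cong[OF sum_powers_mult_eq_div_mod_sum[OF assms(1,2), of i], of "of_int :: int \<Rightarrow> rat"]
    by (simp add: F_def)
  also have "\<dots> = of_int p * of_nat i * (\<Sum>k = 1..i. ?r k)"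
    unfolding sum_distrib_left
  proof (rule sum.cong[OF refl])
    fix k assume "k \<in> {1..i}"
    then have "k > 0" by simp
    \<comment> \<open>Absorption exposes the factor \<open>i\<close>, so that dividing by it leaves
      only \<open>k\<close> in the denominator.\<close>
    then have "of_nat k * of_nat (i choose k) = (of_nat i * of_nat ((i - 1) choose (k - 1)) :: rat)"
      by (metis times_binomial_minus1_eq of_nat_mult)
    then have "(of_nat (i choose k) :: rat) = of_nat i * of_nat ((i - 1) choose (k - 1)) / of_nat k"
      using \<open>k > 0\<close> by (simp add: field_simps)
    moreover have "(of_int p ^ k :: rat) = of_int p * of_int p ^ (k - 1)"
      using \<open>k > 0\<close> by (cases k) auto
    ultimately show "(of_nat (i choose k) * of_int p ^ k * of_int (F k) :: rat) = of_int p * of_nat i * ?r k"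
      by simp
  qed
  finally have "?c * (of_int p * sum ?l {..i}) = of_int p * of_nat i * sum ?r {1..i}"
    unfolding sum_powers_bernoulli[OF \<open>p > 0\<close> \<open>i > 0\<close>] .
  moreover have "x / of_nat i * l = r" if "x * (of_int p * l) = of_int p * of_nat i * r" for x l r :: rat
    using that \<open>p > 0\<close> \<open>i > 0\<close> by (simp add: field_simps)
  ultimately have "?c / of_nat i * sum ?l {..i} = sum ?r {1..i}" by blast
  moreover have "c * l - r = r' - c * l'" if "c * (l + l') = r + r'" for c l l' r r' :: rat
    using that by (simp add: algebra_simps)
  ultimately have eq: "?c / of_nat i * sum ?l {..m} - sum ?r {1..m}
      = sum ?r {Suc m..i} - ?c / of_nat i * sum ?l {Suc m..i}"
    unfolding split by blast
  have R: "p_ideal p m (?r k)" if "k \<in> {Suc m..i}" for k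
  proof -
    have "p_ideal p m (of_int p ^ (k - 1) / of_nat k)"
      using that by (intro p_ideal_power_divide_tail assms) auto
    then have "p_ideal p m (of_int (F k) * (of_nat ((i - 1) choose (k - 1)) * (of_int p ^ (k - 1) / of_nat k)))"
      by (intro p_ideal_mult_left assms) auto
    then show ?thesis by (simp add: mult_ac)
  qed
  \<comment> \<open>One of the \<open>k\<close> factors \<open>p\<close> is spent on making p
    B_(i-k) integral, since i - k may be divisible by p - 1.\<close>
  have L: "p_ideal p m (?l k)" if "k \<in> {Suc m..i}" for k
  proof -
    have "p_ideal p m (of_int p ^ (k - 1) / of_nat (Suc k))"
      using that by (intro p_ideal_power_divide_tail assms) auto
    then have "p_ideal p m (of_nat (i choose k) *
        ((of_int p * bernoulli (i - k)) * (of_int p ^ (k - 1) / of_nat (Suc k))))"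
      by (intro p_ideal_mult_left p_integral_p_mult_bernoulli assms) auto
    moreover have "(of_int p ^ k :: rat) = of_int p * of_int p ^ (k - 1)"
      using that by (cases k) auto
    ultimately show ?thesis by (simp add: mult_ac)
  qed
  have C: "p_integral p (?c / of_nat i)"
    using p_integral_mult[OF assms(1) p_integral_of_int[of p "a ^ i - 1"] p_integral_inverse_int[OF assms(1,3)]]
    by simp
  note p = assms(1)
  show ?thesis
    unfolding eq by (rule p_ideal_diff[OF p p_ideal_sum[OF p R]
          p_ideal_mult_left[OF p C p_ideal_sum[OF p L]]])
qed

section \<open>The congruences for even and odd exponents\<close>

text \<open>Truncation at m = 2. On the Bernoulli side k = 1 vanishes and k = 2 lies in the ideal,
  leaving only B_i.\<close>

lemma bernoulli_quotient_cong:
  fixes p a :: int and i :: nat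
  assumes "prime p" "odd p" "coprime a p" "coprime (int i) p"
    and i: "even i" "0 < i" "\<not> [int i = 2] (mod (p - 1))"
  shows "rat_cong p 2 ((of_int a ^ i - 1) * (bernoulli i / of_nat i))
    (of_int (\<Sum>b = 1..p - 1. (a * b) div p * ((a * b) mod p) ^ (i - 1))
     + of_int p * ((of_nat i - 1) / 2) * of_int a ^ (i - 2)
       * of_int (\<Sum>b = 1..p - 1. ((a * b) div p)\<^sup>2 * b ^ (i - 2)))"
    (is "rat_cong p 2 ?L (of_int ?F1 + of_int p * _ * _ * of_int ?G)")
proof -
  have "p > 1" using assms(1) prime_gt_1_int by blast
  \<comment> \<open>For p = 3 every even \<open>i\<close> would be 2 modulo p - 1. This yields p >=
    5 = 2m + 1.\<close>
  have "p \<noteq> 3" using i by (auto simp: cong_iff_dvd_diff)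
  moreover have "p \<noteq> 2" "p \<noteq> 4" using \<open>odd p\<close> by auto
  ultimately have "p \<ge> 5" using \<open>p > 1\<close> by simp
  have "i \<noteq> 2" using i by auto
  moreover have "i \<noteq> 1" "i \<noteq> 3" using i by auto
  ultimately have "i \<ge> 4" using i by linarith
  have inv: "p_integral p (1 / 2)" "p_integral p (1 / 3)" "p_integral p (1 / of_nat i)"
    using p_ideal_power_divide[OF assms(1), of 2 0 0] p_ideal_power_divide[OF assms(1), of 3 0 0]
      p_integral_inverse_int[OF assms(1,4)] \<open>p \<ge> 5\<close> by simp_all
  define F2 where "F2 = (\<Sum>b = 1..p - 1. ((a * b) div p)\<^sup>2 * ((a * b) mod p) ^ (i - 2))"
  define c :: rat where "c = of_int (a ^ i - 1) * (1 / of_nat i)"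
  define B2 where "B2 = bernoulli (i - 2)"
  define e :: rat where "e = (of_nat i - 1) / 2"
  have "bernoulli (i - Suc 0) = 0" using i \<open>i \<ge> 4\<close> by (intro bernoulli_odd_eq_0) auto
  then have 1: "p_ideal p 2 (c * (bernoulli i + of_nat (i choose 2) * B2 * of_int p ^ 2 / 3)
      - (of_int ?F1 + e * of_int p * of_int F2))"
    using bernoulli_div_mod_sum_truncated[OF assms(1,3,4), of 2] \<open>p \<ge> 5\<close> \<open>i \<ge> 4\<close>
    by (simp add: numeral_2_eq_2 c_def B2_def e_def F2_def of_nat_diff del: of_int_sum)
  have 2: "p_ideal p 2 (of_int p ^ 2 * (c * of_nat (i choose 2) * B2 * (1 / 3)))"
  proof -
    have "p_integral p c" unfolding c_def by (intro p_integral_mult inv assms p_integral_of_int)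
    \<comment> \<open>The excluded residue class is exactly what makes B_(i-2) integral.\<close>
    moreover have "\<not> (p - 1) dvd int (i - 2)"
      using i \<open>i \<ge> 4\<close> by (simp add: cong_iff_dvd_diff of_nat_diff)
    then have "p_integral p B2" unfolding B2_def using assms by (intro p_integral_bernoulli)
    ultimately show ?thesis unfolding p_ideal_def
      by (intro exI[of _ "c * of_nat (i choose 2) * B2 * (1 / 3)"] conjI refl
          p_integral_mult inv assms p_integral_of_nat)
  qed
  have e: "p_integral p e"
    using p_integral_mult[OF assms(1) p_integral_of_int[of p "int i - 1"] inv(1)] by (simp add: e_def)
  have 3: "p_ideal p 2 (e * (of_int p * of_int (F2 - a ^ (i - 2) * ?G)))"
  proof -
    \<comment> \<open>\<open>F2\<close> is multiplied by \<open>p\<close> in the congruence, so its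
      residues may be replaced by ab modulo \<open>p\<close>.\<close>
    have "[F2 = (\<Sum>b = 1..p - 1. ((a * b) div p)\<^sup>2 * (a * b) ^ (i - 2))] (mod p)"
      unfolding F2_def by (intro cong_sum cong_mult cong_pow) (auto simp: cong_def)
    then have "p dvd F2 - a ^ (i - 2) * ?G"
      by (simp add: cong_iff_dvd_diff power_mult_distrib sum_distrib_left mult_ac)
    then have "p_ideal p (Suc 0) (of_int (F2 - a ^ (i - 2) * ?G))"
      using assms(1) by (simp only: p_ideal_of_int_iff power_Suc0_right)
    then show ?thesis
      using p_ideal_p_mult e assms(1) by (simp only: p_ideal_mult_left numeral_2_eq_2)
  qed
  have "p_ideal p 2 (c * (bernoulli i + of_nat (i choose 2) * B2 * of_int p ^ 2 / 3)
      - (of_int ?F1 + e * of_int p * of_int F2)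
      - of_int p ^ 2 * (c * of_nat (i choose 2) * B2 * (1 / 3))
      + e * (of_int p * of_int (F2 - a ^ (i - 2) * ?G)))"
    by (rule p_ideal_add[OF assms(1) p_ideal_diff[OF assms(1) 1 2] 3])
  also have "c * (bernoulli i + of_nat (i choose 2) * B2 * of_int p ^ 2 / 3)
      - (of_int ?F1 + e * of_int p * of_int F2)
      - of_int p ^ 2 * (c * of_nat (i choose 2) * B2 * (1 / 3))
      + e * (of_int p * of_int (F2 - a ^ (i - 2) * ?G))
    = c * bernoulli i - (of_int ?F1 + of_int p * e * of_int a ^ (i - 2) * of_int ?G)"
    (is "_ = _ - ?R")
    by (simp add: algebra_simps del: of_int_sum)
  also have "c * bernoulli i = ?L" by (simp add: c_def)
  finally have diff: "p_ideal p 2 (?L - ?R)" .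
  have R: "p_integral p ?R"
    unfolding of_int_power[symmetric]
    by (intro p_integral_add p_integral_mult p_integral_of_int e assms)
  \<comment> \<open>Integrality of \<open>?L\<close> is read off the congruence: B_i itself need not
    be integral, as p - 1 may divide \<open>i\<close>.\<close>
  then have "p_integral p (?L - ?R + ?R)"
    using p_integral_add[OF assms(1) p_ideal_integral[OF assms(1) diff]] by blast
  then have "p_integral p ?L" by simp
  with R diff show ?thesis unfolding rat_cong_iff e_def by blast
qed

text \<open>Truncation at m = 3. Now k = 0 and k = 2 carry vanishing Bernoulli numbers, so k = 1
  leads with i p B_(i-1) / 2; multiplying by 2/p isolates B_(i-1).\<close>

lemma bernoulli_pred_cong:
  fixes p a :: int and i :: nat
  assumes "prime p" "odd p" "coprime a p" "coprime (int i) p"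
    and i: "odd i" "\<not> [int i = 1] (mod (p - 1))" "\<not> [int i = 3] (mod (p - 1))"
  defines "F \<equiv> \<lambda>k. \<Sum>b = 1..p - 1. ((a * b) div p) ^ k * ((a * b) mod p) ^ (i - k)"
  shows "p dvd F 1"
    and "rat_cong p 2 (bernoulli (i - 1) * (of_int a ^ i - 1))
      (2 / of_int p * of_int (F 1) + (of_nat i - 1) * of_int (F 2)
        + of_int p * ((of_nat i - 1) * (of_nat i - 2) / 3) * of_int (F 3))"
    (is "rat_cong p 2 ?L ?R")
proof -
  have "p > 1" using assms(1) prime_gt_1_int by blast
  \<comment> \<open>Odd \<open>i\<close> is always 1 modulo 2, and 1 or 3 modulo 4; so p = 3 and p =
    5 are excluded, giving p >= 7 = 2m + 1.\<close>
  have "p \<noteq> 3" using i by (auto simp: cong_iff_dvd_diff)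
  moreover have "p \<noteq> 5"
  proof
    assume "p = 5"
    moreover obtain j where "i = 2 * j + 1" using i(1) oddE by blast
    ultimately show False using i(2,3) by (simp add: cong_iff_dvd_diff) presburger
  qed
  moreover have "p \<noteq> 2" "p \<noteq> 4" "p \<noteq> 6" using \<open>odd p\<close> by auto
  ultimately have "p \<ge> 7" using \<open>p > 1\<close> by linarith
  have "i \<noteq> 1" "i \<noteq> 2" "i \<noteq> 3" "i \<noteq> 4" "i > 0" using i by (auto simp: odd_pos)
  then have "i \<ge> 5" by linarith
  have inv: "p_integral p (1 / 2)" "p_integral p (1 / 3)" "p_integral p (1 / of_nat i)"
    using p_ideal_power_divide[OF assms(1), of 2 0 0] p_ideal_power_divide[OF assms(1), of 3 0 0]
      p_integral_inverse_int[OF assms(1,4)] \<open>p \<ge> 7\<close> by simp_all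
  define c :: rat where "c = of_int (a ^ i - 1) * (1 / of_nat i)"
  define B1 B3 where "B1 = bernoulli (i - 1)" and "B3 = bernoulli (i - 3)"
  have B: "p_integral p B1" "p_integral p B3"
    unfolding B1_def B3_def using i \<open>i \<ge> 5\<close> assms(1,2)
    by (auto intro!: p_integral_bernoulli simp: cong_iff_dvd_diff of_nat_diff)
  have c: "p_integral p c" unfolding c_def by (intro p_integral_mult inv assms p_integral_of_int)
  have "2 * ((i - 1) choose 2) = (i - 1) * (i - 2)"
    using times_binomial_minus1_eq[of 2 "i - 1"] by (simp add: numeral_2_eq_2)
  then have "2 * of_nat ((i - 1) choose 2) = (of_nat ((i - 1) * (i - 2)) :: rat)"
    by (metis of_nat_mult of_nat_numeral)
  then have ch: "(of_nat ((i - 1) choose 2) :: rat) = (of_nat i - 1) * (of_nat i - 2) / 2"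
    using \<open>i \<ge> 5\<close> by (simp add: of_nat_diff)
  have zero: "bernoulli i = 0" "bernoulli (i - 2) = 0"
    using i \<open>i \<ge> 5\<close> by (auto intro!: bernoulli_odd_eq_0)
  have "p_ideal p 3 (c * (of_nat i * B1 * of_int p / 2 + of_nat (i choose 3) * B3 * of_int p ^ 3 / 4)
      - (of_int (F 1) + (of_nat i - 1) * of_int p / 2 * of_int (F 2)
         + of_nat ((i - 1) choose 2) * (of_int p ^ 2 / 3) * of_int (F 3)))"
    using bernoulli_div_mod_sum_truncated[OF assms(1,3,4), of 3] \<open>p \<ge> 7\<close> \<open>i \<ge> 5\<close> zero
    by (simp add: numeral_3_eq_3 numeral_2_eq_2 c_def B1_def B3_def F_def of_nat_diff del: of_int_sum)
  \<comment> \<open>Division by \<open>p\<close> lowers the exponent from 3 to 2, which is why the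
    truncation is taken modulo p^3.\<close>
  then have "p_ideal p 2
     ((c * (of_nat i * B1 * of_int p / 2 + of_nat (i choose 3) * B3 * of_int p ^ 3 / 4)
      - (of_int (F 1) + (of_nat i - 1) * of_int p / 2 * of_int (F 2)
         + of_nat ((i - 1) choose 2) * (of_int p ^ 2 / 3) * of_int (F 3))) / of_int p)"
    using assms(1) by (intro p_ideal_divide_p) simp_all
  then have "p_ideal p 2 (of_int 2 *
     ((c * (of_nat i * B1 * of_int p / 2 + of_nat (i choose 3) * B3 * of_int p ^ 3 / 4)
      - (of_int (F 1) + (of_nat i - 1) * of_int p / 2 * of_int (F 2)
         + of_nat ((i - 1) choose 2) * (of_int p ^ 2 / 3) * of_int (F 3))) / of_int p))"
    by (intro p_ideal_mult_left assms p_integral_of_int)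
  moreover have "p_ideal p 2 (of_int p ^ 2 * (c * of_nat (i choose 3) * B3 * (1 / 2)))"
    unfolding p_ideal_def
    by (intro exI[of _ "c * of_nat (i choose 3) * B3 * (1 / 2)"] conjI refl
        p_integral_mult inv assms p_integral_of_nat c B)
  ultimately have "p_ideal p 2 (of_int 2 *
     ((c * (of_nat i * B1 * of_int p / 2 + of_nat (i choose 3) * B3 * of_int p ^ 3 / 4)
      - (of_int (F 1) + (of_nat i - 1) * of_int p / 2 * of_int (F 2)
         + of_nat ((i - 1) choose 2) * (of_int p ^ 2 / 3) * of_int (F 3))) / of_int p)
      - of_int p ^ 2 * (c * of_nat (i choose 3) * B3 * (1 / 2)))"
    by (intro p_ideal_diff assms)
  also have "of_int 2 *
     ((c * (of_nat i * B1 * of_int p / 2 + of_nat (i choose 3) * B3 * of_int p ^ 3 / 4)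
      - (of_int (F 1) + (of_nat i - 1) * of_int p / 2 * of_int (F 2)
         + of_nat ((i - 1) choose 2) * (of_int p ^ 2 / 3) * of_int (F 3))) / of_int p)
      - of_int p ^ 2 * (c * of_nat (i choose 3) * B3 * (1 / 2))
    = c * of_nat i * B1 - ?R"
    unfolding ch using \<open>p > 1\<close> by (simp add: field_simps power2_eq_square power3_eq_cube)
  also have "c * of_nat i * B1 = ?L"
    using \<open>i \<ge> 5\<close> by (simp add: c_def B1_def)
  finally have diff: "p_ideal p 2 (?L - ?R)" .
  have L: "p_integral p ?L"
    using p_integral_mult[OF assms(1) B(1) p_integral_of_int[of p "a ^ i - 1"]] by (simp add: B1_def)
  \<comment> \<open>This cannot be shown termwise, since divisibility of \<open>F 1\<close> by
    \<open>p\<close> is not yet known; it is inherited from \<open>?L\<close>.\<close>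
  then have R: "p_integral p ?R"
    using p_ideal_diff[OF assms(1), of 0 ?L "?L - ?R"] p_ideal_integral[OF assms(1) diff]
    by (simp only: p_ideal_0 diff_diff_eq2 add_diff_cancel_left')
  show "rat_cong p 2 ?L ?R"
    using L R diff unfolding rat_cong_iff by blast
  \<comment> \<open>Subtracting the integral terms of \<open>?R\<close> leaves 2/p times
    \<open>F 1\<close>, whose integrality gives the divisibility because 2 is a unit.\<close>
  have "p_ideal p 0 (?R - (of_int ((int i - 1) * F 2) + of_int (p * ((int i - 1) * (int i - 2)) * F 3) * (1 / 3)))"
    using R by (intro p_ideal_diff assms) (simp_all only: p_ideal_0 p_integral_add p_integral_mult p_integral_of_int inv assms)
  also have "?R - (of_int ((int i - 1) * F 2) + of_int (p * ((int i - 1) * (int i - 2)) * F 3) * (1 / 3))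
      = 2 / of_int p * of_int (F 1)" by (simp add: field_simps)
  finally have "p_ideal p (Suc 0) (of_int p * ((1 / 2) * (2 / of_int p * of_int (F 1))))"
    by (intro p_ideal_p_mult p_ideal_mult_left[OF assms(1) inv(1)])
  then have "p_ideal p (Suc 0) (of_int (F 1))" using \<open>p > 1\<close> by simp
  then show "p dvd F 1" using assms(1) by (simp add: p_ideal_of_int_iff)
qed

theorem theorem2:
  fixes p a :: int and i :: nat
  assumes "prime p" and "odd p"
    and "1 \<le> a" and "a \<le> p - 1"
    and "0 < i" and "coprime (int i) p"
  shows
    "(even i \<and> \<not> [int i = 2] (mod (p - 1)) \<longrightarrow>
       rat_cong p 2
         ((of_int a ^ i - 1) * (bernoulli i / of_nat i))
         (of_int (\<Sum>b = 1..p - 1. \<lfloor>of_int (a * b) / (of_int p :: rat)\<rfloor> * ((a * b) mod p) ^ (i - 1))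
          + of_int p * ((of_nat i - 1) / 2) * of_int a ^ (i - 2)
            * of_int (\<Sum>b = 1..p - 1. \<lfloor>of_int (a * b) / (of_int p :: rat)\<rfloor>\<^sup>2 * b ^ (i - 2))))
     \<and>
     (odd i \<and> \<not> [int i = 1] (mod (p - 1)) \<and> \<not> [int i = 3] (mod (p - 1)) \<longrightarrow>
       p dvd (\<Sum>b = 1..p - 1. \<lfloor>of_int (a * b) / (of_int p :: rat)\<rfloor> * ((a * b) mod p) ^ (i - 1)) \<and>
       rat_cong p 2
         (bernoulli (i - 1) * (of_int a ^ i - 1))
         (2 / of_int p
            * of_int (\<Sum>b = 1..p - 1. \<lfloor>of_int (a * b) / (of_int p :: rat)\<rfloor> * ((a * b) mod p) ^ (i - 1))
          + (of_nat i - 1)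
            * of_int (\<Sum>b = 1..p - 1. \<lfloor>of_int (a * b) / (of_int p :: rat)\<rfloor>\<^sup>2 * ((a * b) mod p) ^ (i - 2))
          + of_int p * ((of_nat i - 1) * (of_nat i - 2) / 3)
            * of_int (\<Sum>b = 1..p - 1. \<lfloor>of_int (a * b) / (of_int p :: rat)\<rfloor> ^ 3 * ((a * b) mod p) ^ (i - 3))))"
proof -
  have "\<not> p dvd a" using assms zdvd_not_zless[of a p] by auto
  then have "coprime a p" using assms(1) prime_imp_coprime coprime_commute by blast
  \<comment> \<open>Floors of rational quotients become \<open>div\<close>, and the exponent 1 in
    \<open>F 1\<close> is simplified away.\<close>
  then show ?thesis
    using bernoulli_quotient_cong[of p a i] bernoulli_pred_cong[of p a i] assms
    by (simp only: floor_divide_of_int_eq power_one_right) blast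
qed

end
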